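(* For every topological $\mathcal A$-module $\mathcal M$ without torsion (multiplication by $\nu$ on $\mathcal M$ is injective) one has the inclusion $V(\mathcal M)\subset V\!A(\mathcal M)$.
   Context: Setting. $V=\mathbb R^d$ carries a polynomial Poisson structure (a bivector field $P$ with real polynomial coefficients and $[P,P]=0$). $A=\mathbb C[x_1,\dots,x_d]$ is the algebra of polynomials on $V^{\mathbb C}=\mathbb C^d$, with the Poisson bracket $\{\cdot,\cdot\}$ extended $\mathbb C$-bilinearly. $\mathcal A=A[[\nu]]$ is equipped with the Duflo–Kontsevich star product $*$: an associative $\mathbb C[[\nu]]$-bilinear product given for $f,g\in A$ by $f*g=fg+\sum_{k\ge1}\nu^kC_k(f,g)$, where the $C_k$ are bidifferential operators with real polynomial coefficients and $f*g-g*f=\nu\{f,g\}+O(\nu^2)$; it is equivalent to Kontsevich's star product and satisfies $f*g=fg$ for $f,g$ in the center of $(\mathcal A,* )$. One identifies $A$ with $\mathcal A/\nu\mathcal A$. A topological $\mathcal A$-module is a $\mathbb C[[\nu]]$-module $\mathcal M$ with a $\mathbb C[[\nu]]$-bilinear map $\mathcal A\times\mathcal M\to\mathcal M$, $(\varphi,m)\mapsto\pi_\nu(\varphi)m$, making it a left $\mathcal A$-module. Then $M=\mathcal M/\nu\mathcal M$ is a module over the commutative algebra $A=\mathcal A/\nu\mathcal A$. The characteristic variety $V(\mathcal M)\subset V^{\mathbb C}$ is the set of common zeros of the annihilator of the $A$-module $M=\mathcal M/\nu\mathcal M$. The Poisson characteristic variety $V\!A(\mathcal M)\subset V^{\mathbb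 C}$ (defined for $\mathcal M$ without torsion) is the set of common zeros of the ideal $\operatorname{Ann}\mathcal M/(\operatorname{Ann}\mathcal M\cap\nu\mathcal A)$ of $A$, where $\operatorname{Ann}\mathcal M=\{\varphi\in\mathcal A:\pi_\nu(\varphi)m=0\ \forall m\in\mathcal M\}$; i.e. of the set of constant terms $\varphi_0$ of elements $\varphi=\varphi_0+\nu\varphi_1+\cdots\in\operatorname{Ann}\mathcal M$. *)

theory Defs
  imports "HOL-Analysis.Analysis" "HOL-Library.Poly_Mapping"
    "HOL-Computational_Algebra.Formal_Power_Series" "HOL-Combinatorics.Permutations"
begin

section \<open>Polynomials\<close>

text \<open>Polynomials in variables \<open>x\<^sub>i\<close>, \<open>i :: 'd\<close>, as the monoid algebra of the multi-indices;
  the product of the type is the usual product of polynomials.\<close>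

type_synonym 'd mindex = "'d \<Rightarrow>\<^sub>0 nat"
type_synonym ('d, 'k) mpol = "'d mindex \<Rightarrow>\<^sub>0 'k"

definition pol_const :: "'k::zero \<Rightarrow> ('d, 'k) mpol"
  where "pol_const c = Poly_Mapping.single 0 c"

definition pol_eval :: "('d::finite, complex) mpol \<Rightarrow> complex ^ 'd \<Rightarrow> complex"
  where "pol_eval p z =
    (\<Sum>m\<in>Poly_Mapping.keys p.
      Poly_Mapping.lookup p m * (\<Prod>i\<in>UNIV. (z $ i) ^ Poly_Mapping.lookup m i))"

definition complexify :: "('d, real) mpol \<Rightarrow> ('d, complex) mpol"
  where "complexify = Poly_Mapping.map complex_of_real"

text \<open>The iterated partial derivative \<open>\<partial>\<^sup>a\<close>. If \<open>a i > m i\<close> for some \<open>i\<close>, then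
  the product of the truncated differences contains a factor 0.\<close>

definition pderivs :: "'d::finite mindex \<Rightarrow> ('d, 'k::comm_semiring_1) mpol \<Rightarrow> ('d, 'k) mpol"
  where "pderivs a p =
    (\<Sum>m\<in>Poly_Mapping.keys p.
      Poly_Mapping.single (m - a)
        (of_nat (\<Prod>i\<in>UNIV. \<Prod>j<Poly_Mapping.lookup a i. Poly_Mapping.lookup m i - j)
          * Poly_Mapping.lookup p m))"

definition pd :: "'d::finite \<Rightarrow> ('d, 'k::comm_semiring_1) mpol \<Rightarrow> ('d, 'k) mpol"
  where "pd i = pderivs (Poly_Mapping.single i 1)"

definition is_diffop :: "(('d::finite, complex) mpol \<Rightarrow> ('d, complex) mpol) \<Rightarrow> bool"
  where "is_diffop D \<longleftrightarrow>
    (\<exists>c :: 'd mindex \<Rightarrow>\<^sub>0 ('d, complex) mpol. \<forall>f.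
      D f = (\<Sum>a\<in>Poly_Mapping.keys c. Poly_Mapping.lookup c a * pderivs a f))"

definition is_real_bidiffop ::
  "(('d::finite, complex) mpol \<Rightarrow> ('d, complex) mpol \<Rightarrow> ('d, complex) mpol) \<Rightarrow> bool"
  where "is_real_bidiffop C \<longleftrightarrow>
    (\<exists>c :: ('d mindex \<times> 'd mindex) \<Rightarrow>\<^sub>0 ('d, real) mpol. \<forall>f g.
      C f g = (\<Sum>(a, b)\<in>Poly_Mapping.keys c.
        complexify (Poly_Mapping.lookup c (a, b)) * pderivs a f * pderivs b g))"


section \<open>Polynomial Poisson structures\<close>

text \<open>\<open>P i j\<close> is the coefficient \<open>{x\<^sub>i, x\<^sub>j}\<close> of the bivector field
  \<open>P = 1/2 \<Sum>\<^sub>i\<^sub>j P i j \<partial>\<^sub>i \<and> \<partial>\<^sub>j\<close>. Up to a nonzero factor depending on conventions,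
  \<open>schouten P i j k\<close> are the components of the trivector field \<open>[P, P]\<close>.\<close>

definition schouten ::
  "('d::finite \<Rightarrow> 'd \<Rightarrow> ('d, real) mpol) \<Rightarrow> 'd \<Rightarrow> 'd \<Rightarrow> 'd \<Rightarrow> ('d, real) mpol"
  where "schouten P i j k =
    (\<Sum>l\<in>UNIV. P i l * pd l (P j k) + P j l * pd l (P k i) + P k l * pd l (P i j))"

definition poisson_structure :: "('d::finite \<Rightarrow> 'd \<Rightarrow> ('d, real) mpol) \<Rightarrow> bool"
  where "poisson_structure P \<longleftrightarrow>
    (\<forall>i j. P i j = - P j i) \<and> (\<forall>i j k. schouten P i j k = 0)"

definition poisson_bracket ::
  "('d::finite \<Rightarrow> 'd \<Rightarrow> ('d, real) mpol) \<Rightarrow>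
    ('d, complex) mpol \<Rightarrow> ('d, complex) mpol \<Rightarrow> ('d, complex) mpol"
  where "poisson_bracket P f g = (\<Sum>i\<in>UNIV. \<Sum>j\<in>UNIV. complexify (P i j) * pd i f * pd j g)"


section \<open>Star products\<close>

text \<open>\<open>\<A> = A[[\<nu>]]\<close> is the type of formal power series over \<open>A\<close>. The product of that type is
  the undeformed product; a star product is a further binary operation on it.\<close>

type_synonym 'd pseries = "('d, complex) mpol fps"

definition nu_scale :: "complex fps \<Rightarrow> 'd pseries \<Rightarrow> 'd pseries"
  where "nu_scale c \<phi> = Abs_fps (\<lambda>n. pol_const (fps_nth c n)) * \<phi>"

definition star_product ::
  "('d::finite \<Rightarrow> 'd \<Rightarrow> ('d, real) mpol) \<Rightarrow> ('d pseries \<Rightarrow> 'd pseries \<Rightarrow> 'd pseries) \<Rightarrow> bool"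
  where "star_product P star \<longleftrightarrow>
    (\<forall>\<phi> \<psi> \<theta>. star (star \<phi> \<psi>) \<theta> = star \<phi> (star \<psi> \<theta>)) \<and>
    (\<forall>\<psi>. module_hom nu_scale nu_scale (\<lambda>\<phi>. star \<phi> \<psi>)) \<and>
    (\<forall>\<phi>. module_hom nu_scale nu_scale (\<lambda>\<psi>. star \<phi> \<psi>)) \<and>
    (\<exists>C. (\<forall>f g. C 0 f g = f * g) \<and>
      (\<forall>k\<ge>1. is_real_bidiffop (C k)) \<and>
      (\<forall>f g. star (fps_const f) (fps_const g) = Abs_fps (\<lambda>k. C k f g)) \<and>
      (\<forall>f g. C 1 f g - C 1 g f = poisson_bracket P f g))"

definition star_center :: "('d pseries \<Rightarrow> 'd pseries \<Rightarrow> 'd pseries) \<Rightarrow> 'd pseries set"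
  where "star_center star = {\<phi>. \<forall>\<psi>. star \<phi> \<psi> = star \<psi> \<phi>}"

text \<open>An equivalence of star products is \<open>T = id + \<Sum>\<^sub>k\<^sub>\<ge>\<^sub>1 \<nu>\<^sup>k T\<^sub>k\<close> with differential operators
  \<open>T\<^sub>k\<close>; it is automatically invertible.\<close>

definition star_equivalent ::
  "('d::finite pseries \<Rightarrow> 'd pseries \<Rightarrow> 'd pseries) \<Rightarrow>
    ('d pseries \<Rightarrow> 'd pseries \<Rightarrow> 'd pseries) \<Rightarrow> bool"
  where "star_equivalent star star' \<longleftrightarrow>
    (\<exists>D. D 0 = id \<and> (\<forall>k\<ge>1. is_diffop (D k)) \<and>
      (let T = \<lambda>\<phi>. Abs_fps (\<lambda>n. \<Sum>i\<le>n. D i (fps_nth \<phi> (n - i)))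
       in \<forall>\<phi> \<psi>. T (star \<phi> \<psi>) = star' (T \<phi>) (T \<psi>)))"


section \<open>Kontsevich's star product\<close>

text \<open>Admissible graphs with \<open>n\<close> aerial vertices and the two ground vertices \<open>0\<close> and \<open>1\<close> of the
  real line. The edges are numbered \<open>0, \<dots>, 2n - 1\<close>; the edges \<open>2k\<close> and \<open>2k + 1\<close>, in this order,
  are those starting at the aerial vertex \<open>k\<close>, and the graph is given by the map sending an edge
  to its target.\<close>

datatype kvertex = Aerial nat | GroundL | GroundR

definition kgraphs :: "nat \<Rightarrow> (nat \<Rightarrow> kvertex) set"
  where "kgraphs n =
    {t \<in> {..<2 * n} \<rightarrow>\<^sub>E (Aerial ` {..<n} \<union> {GroundL, GroundR}).
      (\<forall>e<2 * n. t e \<noteq> Aerial (e div 2)) \<and> (\<forall>k<n. t (2 * k) \<noteq> t (2 * k + 1))}"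

text \<open>Kontsevich's angle is \<open>\<phi>(p, q) = Arg ((q - p) / (q - cnj p))\<close>, which is defined modulo
  \<open>2\<pi>\<close>. Its differential is single-valued; \<open>kangle_deriv p u q v\<close> is its value at \<open>(p, q)\<close> on the
  tangent vector \<open>(u, v)\<close>.\<close>

definition kangle_deriv :: "complex \<Rightarrow> complex \<Rightarrow> complex \<Rightarrow> complex \<Rightarrow> real"
  where "kangle_deriv p u q v = Im ((v - u) / (q - p)) - Im ((v - cnj u) / (q - cnj p))"

text \<open>A configuration of \<open>n\<close> points \<open>p\<^sub>k\<close> is given by its real coordinates
  \<open>x (2k) = Re p\<^sub>k\<close>, \<open>x (2k + 1) = Im p\<^sub>k\<close>.\<close>

fun kpos :: "(nat \<Rightarrow> real) \<Rightarrow> kvertex \<Rightarrow> complex"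
  where
    "kpos x (Aerial k) = Complex (x (2 * k)) (x (2 * k + 1))"
  | "kpos x GroundL = 0"
  | "kpos x GroundR = 1"

text \<open>The derivative of \<open>kpos x v\<close> with respect to the coordinate \<open>x c\<close>.\<close>

fun kvel :: "nat \<Rightarrow> kvertex \<Rightarrow> complex"
  where
    "kvel c (Aerial k) = (if c = 2 * k then 1 else if c = 2 * k + 1 then \<i> else 0)"
  | "kvel c GroundL = 0"
  | "kvel c GroundR = 0"

definition kconfig :: "nat \<Rightarrow> (nat \<Rightarrow> real) set"
  where "kconfig n =
    {x \<in> {..<2 * n} \<rightarrow>\<^sub>E UNIV. (\<forall>k<n. 0 < Im (kpos x (Aerial k))) \<and>
      inj_on (\<lambda>k. kpos x (Aerial k)) {..<n}}"

text \<open>The coefficient of the form \<open>d\<phi>\<^sub>e\<^sub>_\<^sub>0 \<and> d\<phi>\<^sub>e\<^sub>_\<^sub>1 \<and> \<dots>\<close> (wedge over all edges, in order) with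
  respect to the volume form \<open>dx\<^sub>0 \<and> dx\<^sub>1 \<and> \<dots>\<close>, i.e. the Jacobian determinant of the angles.\<close>

definition kform :: "nat \<Rightarrow> (nat \<Rightarrow> kvertex) \<Rightarrow> (nat \<Rightarrow> real) \<Rightarrow> real"
  where "kform n t x =
    (\<Sum>\<sigma> | \<sigma> permutes {..<2 * n}. of_int (sign \<sigma>) *
      (\<Prod>e<2 * n. kangle_deriv
        (kpos x (Aerial (e div 2))) (kvel (\<sigma> e) (Aerial (e div 2)))
        (kpos x (t e)) (kvel (\<sigma> e) (t e))))"

definition kweight :: "nat \<Rightarrow> (nat \<Rightarrow> kvertex) \<Rightarrow> real"
  where "kweight n t =
    (LINT x : kconfig n | (\<Pi>\<^sub>M c\<in>{..<2 * n}. lborel). kform n t x)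
      / (fact n * (2 * pi) ^ (2 * n))"

text \<open>The multi-index collecting the derivatives which the edges ending at \<open>v\<close> apply to \<open>v\<close>,
  for a labelling \<open>I\<close> of the edges by coordinate indices.\<close>

definition kincoming :: "nat \<Rightarrow> (nat \<Rightarrow> kvertex) \<Rightarrow> (nat \<Rightarrow> 'd) \<Rightarrow> kvertex \<Rightarrow> 'd mindex"
  where "kincoming n t I v = (\<Sum>e | e < 2 * n \<and> t e = v. Poly_Mapping.single (I e) 1)"

definition kgraph_op ::
  "('d::finite \<Rightarrow> 'd \<Rightarrow> ('d, complex) mpol) \<Rightarrow> nat \<Rightarrow> (nat \<Rightarrow> kvertex) \<Rightarrow>
    ('d, complex) mpol \<Rightarrow> ('d, complex) mpol \<Rightarrow> ('d, complex) mpol"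
  where "kgraph_op \<alpha> n t f g =
    (\<Sum>I \<in> {..<2 * n} \<rightarrow>\<^sub>E UNIV.
      (\<Prod>k<n. pderivs (kincoming n t I (Aerial k)) (\<alpha> (I (2 * k)) (I (2 * k + 1))))
      * pderivs (kincoming n t I GroundL) f * pderivs (kincoming n t I GroundR) g)"

text \<open>Kontsevich's formula gives \<open>f g + \<nu> \<Sum>\<^sub>i\<^sub>j \<alpha>\<^sup>i\<^sup>j \<partial>\<^sub>i f \<partial>\<^sub>j g + O(\<nu>\<^sup>2)\<close>, so
  \<open>\<alpha> = P / 2\<close> is the normalisation for which the commutator is \<open>\<nu> {f, g} + O(\<nu>\<^sup>2)\<close>.\<close>

definition kontsevich_coeff ::
  "('d::finite \<Rightarrow> 'd \<Rightarrow> ('d, real) mpol) \<Rightarrow> nat \<Rightarrow>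
    ('d, complex) mpol \<Rightarrow> ('d, complex) mpol \<Rightarrow> ('d, complex) mpol"
  where "kontsevich_coeff P n f g =
    (\<Sum>t\<in>kgraphs n. pol_const (complex_of_real (kweight n t))
      * kgraph_op (\<lambda>i j. pol_const (1 / 2) * complexify (P i j)) n t f g)"

definition kontsevich_star ::
  "('d::finite \<Rightarrow> 'd \<Rightarrow> ('d, real) mpol) \<Rightarrow> 'd pseries \<Rightarrow> 'd pseries \<Rightarrow> 'd pseries"
  where "kontsevich_star P \<phi> \<psi> =
    Abs_fps (\<lambda>n. \<Sum>i\<le>n. \<Sum>j\<le>n - i.
      kontsevich_coeff P (n - i - j) (fps_nth \<phi> i) (fps_nth \<psi> j))"

definition duflo_kontsevich ::
  "('d::finite \<Rightarrow> 'd \<Rightarrow> ('d, real) mpol) \<Rightarrow> ('d pseries \<Rightarrow> 'd pseries \<Rightarrow> 'd pseries) \<Rightarrow> bool"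
  where "duflo_kontsevich P star \<longleftrightarrow>
    star_product P star \<and>
    star_equivalent star (kontsevich_star P) \<and>
    (\<forall>\<phi>\<in>star_center star. \<forall>\<psi>\<in>star_center star. star \<phi> \<psi> = \<phi> * \<psi>)"


section \<open>Topological modules and their characteristic varieties\<close>

text \<open>A \<open>\<complex>[[\<nu>]]\<close>-module with scalar multiplication \<open>scal\<close> on the type \<open>'m\<close>, and an action \<open>act\<close>
  (the map \<open>\<pi>\<^sub>\<nu>\<close>) of \<open>\<A>\<close> on it. The constant series 1 is the unit of a Duflo-Kontsevich star
  product: a unit \<open>u\<close> is central, so \<open>u = star u u = u * u\<close>, with constant term 1.\<close>

definition topological_module ::
  "('d pseries \<Rightarrow> 'd pseries \<Rightarrow> 'd pseries) \<Rightarrow>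
    (complex fps \<Rightarrow> 'm::ab_group_add \<Rightarrow> 'm) \<Rightarrow> ('d pseries \<Rightarrow> 'm \<Rightarrow> 'm) \<Rightarrow> bool"
  where "topological_module star scal act \<longleftrightarrow>
    module scal \<and>
    (\<forall>m. module_hom nu_scale scal (\<lambda>\<phi>. act \<phi> m)) \<and>
    (\<forall>\<phi>. module_hom scal scal (act \<phi>)) \<and>
    (\<forall>\<phi> \<psi> m. act (star \<phi> \<psi>) m = act \<phi> (act \<psi> m)) \<and>
    (\<forall>m. act 1 m = m)"

definition torsion_free :: "(complex fps \<Rightarrow> 'm \<Rightarrow> 'm) \<Rightarrow> bool"
  where "torsion_free scal \<longleftrightarrow> inj (scal fps_X)"

text \<open>The elements of \<open>M = \<M>/\<nu>\<M>\<close> are the cosets of \<open>\<nu>\<M>\<close>; the zero element is \<open>nu_coset scal 0\<close>.\<close>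

definition nu_coset :: "(complex fps \<Rightarrow> 'm::ab_group_add \<Rightarrow> 'm) \<Rightarrow> 'm \<Rightarrow> 'm set"
  where "nu_coset scal m = (\<lambda>x. m + scal fps_X x) ` UNIV"

definition nu_quotient :: "(complex fps \<Rightarrow> 'm::ab_group_add \<Rightarrow> 'm) \<Rightarrow> 'm set set"
  where "nu_quotient scal = nu_coset scal ` UNIV"

text \<open>The action of \<open>A = \<A>/\<nu>\<A>\<close> on \<open>M\<close> induced by \<open>act\<close>: the element \<open>f\<close> of \<open>A\<close> is the class of
  all series with constant term \<open>f\<close>. All cosets in the union coincide.\<close>

definition quotient_act ::
  "(complex fps \<Rightarrow> 'm::ab_group_add \<Rightarrow> 'm) \<Rightarrow> ('d pseries \<Rightarrow> 'm \<Rightarrow> 'm) \<Rightarrow>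
    ('d, complex) mpol \<Rightarrow> 'm set \<Rightarrow> 'm set"
  where "quotient_act scal act f Q =
    (\<Union>\<phi>\<in>{\<phi>. fps_nth \<phi> 0 = f}. \<Union>m\<in>Q. nu_coset scal (act \<phi> m))"

definition quotient_ann ::
  "(complex fps \<Rightarrow> 'm::ab_group_add \<Rightarrow> 'm) \<Rightarrow> ('d pseries \<Rightarrow> 'm \<Rightarrow> 'm) \<Rightarrow>
    ('d, complex) mpol set"
  where "quotient_ann scal act =
    {f. \<forall>Q\<in>nu_quotient scal. quotient_act scal act f Q = nu_coset scal 0}"

definition module_ann :: "('d pseries \<Rightarrow> 'm::zero \<Rightarrow> 'm) \<Rightarrow> 'd pseries set"
  where "module_ann act = {\<phi>. \<forall>m. act \<phi> m = 0}"

definition common_zeros :: "('d::finite, complex) mpol set \<Rightarrow> (complex ^ 'd) set"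
  where "common_zeros S = {z. \<forall>f\<in>S. pol_eval f z = 0}"

definition char_variety ::
  "(complex fps \<Rightarrow> 'm::ab_group_add \<Rightarrow> 'm) \<Rightarrow> ('d::finite pseries \<Rightarrow> 'm \<Rightarrow> 'm) \<Rightarrow> (complex ^ 'd) set"
  where "char_variety scal act = common_zeros (quotient_ann scal act)"

definition poisson_char_variety ::
  "('d::finite pseries \<Rightarrow> 'm::ab_group_add \<Rightarrow> 'm) \<Rightarrow> (complex ^ 'd) set"
  where "poisson_char_variety act = common_zeros ((\<lambda>\<phi>. fps_nth \<phi> 0) ` module_ann act)"

end

theory Submission
  imports Defs
begin

text \<open>Taking common zeros reverses inclusions, so it suffices that the constant term of every
  \<phi> annihilating the module also annihilates its reduction modulo \<nu>. Any other series with
  that constant term differs from \<phi> by a multiple of \<nu>, so by linearity over the scalar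
  power series it maps the module into its \<nu>-multiples, that is, to zero in the quotient. The
  key lemma is \<open>quotient_act_module_ann\<close>.\<close>

lemma nu_scale_fps_X:
  fixes \<phi> :: "'d pseries"
  shows "nu_scale fps_X \<phi> = fps_X * \<phi>"
proof -
  have "Abs_fps (\<lambda>n. pol_const (fps_nth fps_X n)) = (fps_X :: 'd pseries)"
    by (rule fps_ext) (simp add: pol_const_def fps_X_def single_one)
  then show ?thesis
    by (simp only: nu_scale_def)
qed

text \<open>A series with zero constant term is divisible by \<nu>, the quotient being its shift.
  This compares two lifts of one polynomial.\<close>

lemma fps_nth_0_eq_imp_diff_eq_nu_scale:
  fixes \<phi> \<psi> :: "'d pseries"
  assumes "fps_nth \<phi> 0 = fps_nth \<psi> 0"
  obtains \<theta> where "\<phi> = \<psi> + nu_scale fps_X \<theta>"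
proof
  have "\<phi> - \<psi> = fps_X * fps_shift 1 (\<phi> - \<psi>)"
    using assms by (intro fps_ext) (simp add: fps_X_mult_nth)
  then show "\<phi> = \<psi> + nu_scale fps_X (fps_shift 1 (\<phi> - \<psi>))"
    unfolding nu_scale_fps_X by (metis add_diff_cancel_left' diff_add_cancel add.commute)
qed

lemma nu_coset_scal_fps_X:
  assumes "module scal"
  shows "nu_coset scal (scal fps_X y) = nu_coset scal 0"
proof -
  interpret module scal by fact
  have "scal fps_X y + scal fps_X x = 0 + scal fps_X (y + x)"
    and "0 + scal fps_X x = scal fps_X y + scal fps_X (x - y)" for x
    by (simp_all add: scale_right_distrib scale_right_diff_distrib)
  then show ?thesis
    unfolding nu_coset_def by (metis (no_types, lifting) image_subset_iff rangeI subset_antisym)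
qed

text \<open>\<open>quotient_act\<close> is a union over all lifts of the polynomial, so every lift
  \<psi> has to be treated, not only the annihilating \<phi>.\<close>

lemma quotient_act_module_ann:
  assumes "topological_module star scal act"
    and "\<phi> \<in> module_ann act"
    and "Q \<noteq> {}"
  shows "quotient_act scal act (fps_nth \<phi> 0) Q = nu_coset scal 0"
proof -
  have "nu_coset scal (act \<psi> m) = nu_coset scal 0" if "fps_nth \<psi> 0 = fps_nth \<phi> 0" for \<psi> m
  proof -
    interpret hom: module_hom nu_scale scal "\<lambda>\<phi>. act \<phi> m"
      using assms(1) by (simp add: topological_module_def)
    obtain \<theta> where "\<psi> = \<phi> + nu_scale fps_X \<theta>"
      using \<open>fps_nth \<psi> 0 = fps_nth \<phi> 0\<close> by (rule fps_nth_0_eq_imp_diff_eq_nu_scale)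
    \<comment> \<open>The \<phi>-part kills \<open>m\<close>, and linearity in the series pulls
      \<nu> out of the rest.\<close>
    then have "act \<psi> m = scal fps_X (act \<theta> m)"
      using assms(2) by (simp add: hom.add hom.scale module_ann_def)
    then show ?thesis
      using assms(1) by (simp add: topological_module_def nu_coset_scal_fps_X)
  qed
  then show ?thesis
    using \<open>Q \<noteq> {}\<close> unfolding quotient_act_def by auto
qed

lemma fps_nth_0_module_ann_subset_quotient_ann:
  assumes "topological_module star scal act"
  shows "(\<lambda>\<phi>. fps_nth \<phi> 0) ` module_ann act \<subseteq> quotient_ann scal act"
proof -
  \<comment> \<open>Over an empty \<open>Q\<close> the union defining \<open>quotient_act\<close>
    would be empty instead of the zero coset.\<close>
  have "Q \<noteq> {}" if "Q \<in> nu_quotient scal" for Q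
    using that by (auto simp: nu_quotient_def nu_coset_def)
  then show ?thesis
    using quotient_act_module_ann[OF assms] by (auto simp: quotient_ann_def)
qed

theorem propositionI5p4:
  fixes P :: "'d::finite \<Rightarrow> 'd \<Rightarrow> ('d, real) mpol"
    and star :: "'d pseries \<Rightarrow> 'd pseries \<Rightarrow> 'd pseries"
    and scal :: "complex fps \<Rightarrow> 'm::ab_group_add \<Rightarrow> 'm"
    and act :: "'d pseries \<Rightarrow> 'm \<Rightarrow> 'm"
  assumes "poisson_structure P"
    and "duflo_kontsevich P star"
    and "topological_module star scal act"
    and "torsion_free scal"
  shows "char_variety scal act \<subseteq> poisson_char_variety act"
  using fps_nth_0_module_ann_subset_quotient_ann[OF assms(3)]
  unfolding char_variety_def poisson_char_variety_def common_zeros_def by blast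

end
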